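(* For every integer $m$ and every nonnegative integer $n$, $$N(3m-1,n)+N(3m,n)+N(3m+1,n)=\sum_{0\le 3k\le n}M(m,k)\,p_3(n-3k).$$
   Context: The rank of a partition is its largest part minus its number of parts; $N(m,n)$ is the number of partitions of $n$ with rank $m$ (with the convention $N(0,0)=1$, $N(m,0)=0$ for $m\neq0$, i.e. $\sum_{m,n}N(m,n)w^mq^n=\sum_{n\ge0}\frac{q^{n^2}}{\prod_{k=1}^n(1-wq^k)(1-q^k/w)}$). The crank of a partition is its largest part if $1$ does not appear as a part, and $e(k)-k$ if $1$ appears exactly $k$ times, where $e(k)$ is the number of parts strictly larger than $k$. $M(m,n)$ is the number of partitions of $n$ with crank $m$, for $n\ge2$; with the conventions $M(0,0)=1$, $M(m,0)=0$ for $m\ne0$, $M(0,1)=-1$, $M(\pm1,1)=1$, $M(m,1)=0$ otherwise, one has $\sum_{m,n}M(m,n)w^mq^n=\frac{(q;q)_\infty}{(wq;q)_\infty(q/w;q)_\infty}$. $p_3(n)$ is the number of partitions of $n$ into parts congruent to $\pm1$ modulo $3$. *)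

theory Defs
  imports "HOL-Library.Multiset" "HOL-Number_Theory.Cong"
begin

definition partitions_of :: "nat \<Rightarrow> nat multiset set" where
  "partitions_of n = {p. 0 \<notin># p \<and> sum_mset p = n}"

lemma size_le_sum_mset:
  fixes p :: "nat multiset"
  assumes "0 \<notin># p"
  shows "size p \<le> sum_mset p"
  using assms by (induction p) auto

lemma finite_partitions_of: "finite (partitions_of n)"
proof (rule finite_surj)
  show "finite {xs. set xs \<subseteq> {..n} \<and> length xs \<le> n}"
    by (intro finite_lists_length_le) simp
  show "partitions_of n \<subseteq> mset ` {xs. set xs \<subseteq> {..n} \<and> length xs \<le> n}"
  proof
    fix p assume p: "p \<in> partitions_of n"
    obtain xs where xs: "p = mset xs"
      by (metis ex_mset)
    have "set xs \<subseteq> {..n}"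
      using p xs by (auto simp: partitions_of_def sum_mset_sum_list intro: member_le_sum_list)
    moreover have "length xs \<le> n"
      using p xs size_le_sum_mset[of p] by (auto simp: partitions_of_def)
    ultimately show "p \<in> mset ` {xs. set xs \<subseteq> {..n} \<and> length xs \<le> n}"
      using xs by blast
  qed
qed

definition largest_part :: "nat multiset \<Rightarrow> nat" where
  "largest_part p = Max (set_mset p)"

text \<open>
  The largest part of the empty partition is the unspecified value of \<open>Max {}\<close>;
  \<open>N_rank\<close> and \<open>M_crank\<close> below therefore treat \<open>n = 0\<close> separately.
\<close>

definition partition_rank :: "nat multiset \<Rightarrow> int" where
  "partition_rank p = int (largest_part p) - int (size p)"

definition partition_crank :: "nat multiset \<Rightarrow> int" where
  "partition_crank p =
    (let k = count p 1
     in if k = 0 then int (largest_part p)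
        else int (size {#x \<in># p. k < x#}) - int k)"

definition N_rank :: "int \<Rightarrow> nat \<Rightarrow> nat" where
  "N_rank m n =
    (if n = 0 then (if m = 0 then 1 else 0)
     else card {p \<in> partitions_of n. partition_rank p = m})"

text \<open>
  \<open>M_crank m 1\<close> is not a count: the only partition of \<open>1\<close> has crank \<open>-1\<close>, but the values
  at \<open>n = 1\<close> are set by convention to the coefficients of \<open>q\<close> in
  \<open>(q;q)\<^sub>\<infinity> / ((wq;q)\<^sub>\<infinity> (q/w;q)\<^sub>\<infinity>)\<close>, that is, to \<open>w - 1 + 1/w\<close>.
\<close>

definition M_crank :: "int \<Rightarrow> nat \<Rightarrow> int" where
  "M_crank m n =
    (if n = 0 then (if m = 0 then 1 else 0)
     else if n = 1 then (if m = 0 then -1 else if m = 1 \<or> m = -1 then 1 else 0)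
     else int (card {p \<in> partitions_of n. partition_crank p = m}))"

definition p3 :: "nat \<Rightarrow> nat" where
  "p3 n = card {p \<in> partitions_of n.
     \<forall>x \<in># p. [int x = 1] (mod 3) \<or> [int x = -1] (mod 3)}"

end

theory Submission
  imports Defs "HOL-Computational_Algebra.Formal_Power_Series"
begin

text \<open>
  Let \<open>G\<^sub>r(q)\<close> and \<open>C\<^sub>m(q)\<close> be the generating functions of the partitions of rank at least \<open>r\<close> and of
  crank at least \<open>m\<close>, let \<open>P(q)\<close> be that of all partitions and \<open>P\<^sub>3(q)\<close> that of \<open>p3\<close>. Dyson's adjoint
  gives \<open>G\<^sub>r = q\<^bsup>r+1\<^esup> (P - G\<^bsub>r+3\<^esub>)\<close>, and there is an analogous relation \<open>C\<^sub>m = q\<^sup>m (P - C\<^bsub>m+1\<^esub>)\<close> for cranks.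
  Since \<open>P(q) = P\<^sub>3(q) P(q\<^sup>3)\<close>, the series \<open>G\<^bsub>3m-1\<^esub>(q)\<close> and \<open>P\<^sub>3(q) C\<^sub>m(q\<^sup>3)\<close> satisfy the same recurrence in
  \<open>m \<ge> 1\<close>, hence are equal. Taking differences in \<open>m\<close> settles \<open>m \<ge> 1\<close>; the symmetries of rank and crank
  under \<open>m \<mapsto> -m\<close> give the other cases.

  The crank relations come from the fact that the partitions with \<open>k \<ge> 1\<close> ones and \<open>e\<close> parts larger
  than \<open>k\<close> have generating function \<open>(1 - q) q\<^bsup>k+e+ke\<^esup> / ((q)\<^sub>k (q)\<^sub>e)\<close>, which is symmetric in \<open>k\<close> and \<open>e\<close>.
\<close>

section \<open>Generating functions of sets of multisets\<close>

text \<open>\<open>card\<close> is 0 on infinite sets, so \<open>gf\<close> counts correctly only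
  under this condition. It can fail because multisets may contain zeros, which do not change the
  sum.\<close>

definition level_finite :: "nat multiset set \<Rightarrow> bool" where
  "level_finite A \<longleftrightarrow> (\<forall>n. finite {p \<in> A. sum_mset p = n})"

definition gf :: "nat multiset set \<Rightarrow> int fps" where
  "gf A = Abs_fps (\<lambda>n. int (card {p \<in> A. sum_mset p = n}))"

lemma gf_nth: "fps_nth (gf A) n = int (card {p \<in> A. sum_mset p = n})"
  by (simp add: gf_def)

lemma level_finite_pos: "level_finite {p. 0 \<notin># p \<and> P p}"
  unfolding level_finite_def
  by (auto intro: finite_subset[OF _ finite_partitions_of] simp: partitions_of_def)

lemma sum_mset_image_add:
  "sum_mset (image_mset (\<lambda>x. x + d) p) = sum_mset p + d * size (p :: nat multiset)"
  by (induction p) auto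

text \<open>With zeros allowed, the fixed size gives the bound: adding 1 to every entry maps the
  multisets of sum \<open>n\<close> injectively into \<open>partitions_of (n + e)\<close>.\<close>

lemma level_finite_size: "level_finite {p. size p = e \<and> P p}"
  unfolding level_finite_def
proof
  fix n
  let ?S = "{p \<in> {p. size p = e \<and> P p}. sum_mset p = n}"
  have "image_mset (\<lambda>x. x + 1) ` ?S \<subseteq> partitions_of (n + e)"
    using sum_mset_image_add[of 1] by (auto simp: partitions_of_def)
  then have "finite (image_mset (\<lambda>x. x + 1) ` ?S)"
    by (rule finite_subset) (rule finite_partitions_of)
  moreover have "inj_on (image_mset (\<lambda>x::nat. x + 1)) ?S"
    by (intro inj_on_subset[OF multiset.inj_map[of "\<lambda>x::nat. x + 1"] subset_UNIV]) (simp add: inj_def)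
  ultimately show "finite ?S"
    by (rule finite_imageD)
qed

lemma level_finite_subset: "level_finite B \<Longrightarrow> A \<subseteq> B \<Longrightarrow> level_finite A"
  unfolding level_finite_def
proof
  fix n
  assume "\<forall>n. finite {p \<in> B. sum_mset p = n}" "A \<subseteq> B"
  then show "finite {p \<in> A. sum_mset p = n}"
    by (intro finite_subset[of "{p \<in> A. sum_mset p = n}" "{p \<in> B. sum_mset p = n}"]) auto
qed

lemma gf_Un:
  assumes "level_finite A" "level_finite B" "A \<inter> B = {}"
  shows "gf (A \<union> B) = gf A + gf B"
proof (rule fps_ext)
  fix n
  have "{p \<in> A \<union> B. sum_mset p = n} = {p \<in> A. sum_mset p = n} \<union> {p \<in> B. sum_mset p = n}"
    by auto
  moreover have "card ({p \<in> A. sum_mset p = n} \<union> {p \<in> B. sum_mset p = n})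
      = card {p \<in> A. sum_mset p = n} + card {p \<in> B. sum_mset p = n}"
    using assms by (intro card_Un_disjoint) (auto simp: level_finite_def)
  ultimately show "fps_nth (gf (A \<union> B)) n = fps_nth (gf A + gf B) n"
    by (simp add: gf_nth)
qed

lemma gf_bij:
  assumes bij: "bij_betw f A B" and sum: "\<And>p. p \<in> A \<Longrightarrow> sum_mset (f p) = sum_mset p + d"
  shows "gf B = fps_X ^ d * gf A"
proof (rule fps_ext)
  fix n
  have inj: "inj_on f A" and img: "B = f ` A"
    using bij by (auto simp: bij_betw_def)
  show "fps_nth (gf B) n = fps_nth (fps_X ^ d * gf A) n"
  proof (cases "n < d")
    case True
    then have "{p \<in> B. sum_mset p = n} = {}"
      using sum img by auto
    then have "card {p \<in> B. sum_mset p = n} = 0"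
      by (simp only: card.empty)
    then show ?thesis
      using True by (simp add: gf_nth fps_X_power_mult_nth)
  next
    case False
    have "f ` {p \<in> A. sum_mset p = n - d} = {p \<in> B. sum_mset p = n}"
      using False sum img by fastforce
    moreover have "inj_on f {p \<in> A. sum_mset p = n - d}"
      using inj by (rule inj_on_subset) auto
    ultimately show ?thesis
      using False card_image[of f "{p \<in> A. sum_mset p = n - d}"]
      by (simp add: gf_nth fps_X_power_mult_nth)
  qed
qed

text \<open>Cutting a multiset into its entries inside and outside \<open>T\<close> identifies the
  set on the left with \<open>A \<times> B\<close>. Sorting the pairs by the sum of the first
  component gives the Cauchy product.\<close>

lemma gf_mult:
  assumes A: "\<And>p. p \<in> A \<Longrightarrow> set_mset p \<subseteq> T" and B: "\<And>p. p \<in> B \<Longrightarrow> set_mset p \<inter> T = {}"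
    and finA: "level_finite A" and finB: "level_finite B"
  shows "gf {p. {#x \<in># p. x \<in> T#} \<in> A \<and> {#x \<in># p. x \<notin> T#} \<in> B} = gf A * gf B"
    (is "gf ?C = _")
proof (rule fps_ext)
  fix n
  let ?L = "\<lambda>A n. {p \<in> A. sum_mset p = n}"
  let ?U = "SIGMA i:{0..n}. ?L A i \<times> ?L B (n - i)"
  have ra: "{#x \<in># p. x \<in> T#} = p \<and> {#x \<in># p. x \<notin> T#} = {#}" if "p \<in> A" for p
    using A[OF that] by (auto simp: filter_mset_eq_conv filter_mset_eq_mempty_iff)
  have rb: "{#x \<in># p. x \<in> T#} = {#} \<and> {#x \<in># p. x \<notin> T#} = p" if "p \<in> B" for p
    using B[OF that] by (auto simp: filter_mset_eq_conv filter_mset_eq_mempty_iff)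
  have "bij_betw (\<lambda>(i, a, b). a + b) ?U (?L ?C n)"
  proof (rule bij_betw_byWitness[where f' = "\<lambda>p. (sum_mset {#x \<in># p. x \<in> T#}, {#x \<in># p. x \<in> T#}, {#x \<in># p. x \<notin> T#})"])
    show "\<forall>u\<in>?U. (\<lambda>p. (sum_mset {#x \<in># p. x \<in> T#}, {#x \<in># p. x \<in> T#}, {#x \<in># p. x \<notin> T#}))
        ((\<lambda>(i, a, b). a + b) u) = u"
      by (auto simp: ra rb)
    show "\<forall>p\<in>?L ?C n. (\<lambda>(i, a, b). a + b)
        (sum_mset {#x \<in># p. x \<in> T#}, {#x \<in># p. x \<in> T#}, {#x \<in># p. x \<notin> T#}) = p"
      by (auto simp flip: multiset_partition)
    show "(\<lambda>(i, a, b). a + b) ` ?U \<subseteq> ?L ?C n"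
      by (auto simp: ra rb)
    have "sum_mset {#x \<in># p. x \<in> T#} + sum_mset {#x \<in># p. x \<notin> T#} = sum_mset p" for p
      by (simp flip: sum_mset.union multiset_partition)
    then have "sum_mset {#x \<in># p. x \<in> T#} \<le> sum_mset p"
        "sum_mset {#x \<in># p. x \<notin> T#} = sum_mset p - sum_mset {#x \<in># p. x \<in> T#}" for p
      by (metis le_add1, metis add_diff_cancel_left')
    then show "(\<lambda>p. (sum_mset {#x \<in># p. x \<in> T#}, {#x \<in># p. x \<in> T#}, {#x \<in># p. x \<notin> T#})) ` ?L ?C n \<subseteq> ?U"
      by auto
  qed
  then have "card (?L ?C n) = card ?U"
    by (rule bij_betw_same_card[symmetric])
  also have "\<dots> = (\<Sum>i\<in>{0..n}. card (?L A i) * card (?L B (n - i)))"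
    using finA finB by (subst card_SigmaI) (auto simp: level_finite_def card_cartesian_product)
  finally show "fps_nth (gf ?C) n = fps_nth (gf A * gf B) n"
    by (simp add: gf_nth fps_mult_nth)
qed

section \<open>Partitions with restricted parts\<close>

definition parts_in :: "nat set \<Rightarrow> nat multiset set" where
  "parts_in A = {p. set_mset p \<subseteq> A}"

lemma level_finite_parts_in: "0 \<notin> A \<Longrightarrow> level_finite (parts_in A)"
  by (rule level_finite_subset[OF level_finite_pos[of "\<lambda>_. True"]]) (auto simp: parts_in_def)

lemma bij_betw_add_mset:
  "bij_betw (add_mset a) {p. P (add_mset a p)} {p. a \<in># p \<and> P p}"
  by (rule bij_betw_byWitness[where f' = "\<lambda>p. p - {#a#}"]) auto

text \<open>Deleting one copy of \<open>a\<close> from the multisets that contain it gives back all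
  of \<open>parts_in (insert a A)\<close>. The factor stays on the left to avoid dividing power
  series.\<close>

lemma gf_parts_in_insert:
  assumes "0 \<notin> insert a A" "a \<notin> A"
  shows "(1 - fps_X ^ a) * gf (parts_in (insert a A)) = gf (parts_in A)"
proof -
  have "parts_in (insert a A) = parts_in A \<union> {p. a \<in># p \<and> set_mset p \<subseteq> insert a A}"
    by (auto simp: parts_in_def)
  moreover have "gf (parts_in A \<union> {p. a \<in># p \<and> set_mset p \<subseteq> insert a A})
      = gf (parts_in A) + gf {p. a \<in># p \<and> set_mset p \<subseteq> insert a A}"
    using assms
    by (intro gf_Un level_finite_parts_in
        level_finite_subset[OF level_finite_parts_in[of "insert a A"]])
      (auto simp: parts_in_def)
  moreover have "gf {p. a \<in># p \<and> set_mset p \<subseteq> insert a A} = fps_X ^ a * gf (parts_in (insert a A))"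
    using bij_betw_add_mset[of a "\<lambda>p. set_mset p \<subseteq> insert a A"]
    by (intro gf_bij[where f = "add_mset a"]) (auto simp: parts_in_def)
  ultimately show ?thesis
    by (simp add: algebra_simps)
qed

lemma gf_empty: "gf {{#}} = 1"
proof (rule fps_ext)
  fix n :: nat
  have "{p \<in> {{#}}. sum_mset p = n} = (if n = 0 then {{#}} else {})"
    by auto
  then show "fps_nth (gf {{#}}) n = fps_nth 1 n"
    by (simp only: gf_nth) simp
qed

text \<open>This is the series 1 / ((1 - q) ... (1 - q^k)).\<close>

definition gf_le :: "nat \<Rightarrow> int fps" where
  "gf_le k = gf (parts_in {1..k})"

lemma gf_le_0: "gf_le 0 = 1"
proof -
  have "parts_in {1..0} = {{#}}"
    by (auto simp: parts_in_def)
  then show ?thesis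
    by (simp add: gf_le_def gf_empty)
qed

lemma gf_le_Suc: "(1 - fps_X ^ Suc k) * gf_le (Suc k) = gf_le k"
  using gf_parts_in_insert[of "Suc k" "{1..k}"]
  by (simp add: gf_le_def atLeastAtMostSuc_conv del: power_Suc)

lemma gf_parts_in_2:
  assumes "k \<ge> 1"
  shows "gf (parts_in {2..k}) = (1 - fps_X) * gf_le k"
proof -
  have "{1..k} = insert 1 {2..k}"
    using assms by auto
  then show ?thesis
    using gf_parts_in_insert[of 1 "{2..k}"] by (simp add: gf_le_def)
qed

section \<open>Multisets of fixed size, zeros allowed\<close>

text \<open>Entries may be 0, so these stand for the partitions into at most \<open>l\<close> parts,
  all at most \<open>a\<close>. Their generating function is a Gaussian binomial
  coefficient.\<close>

definition box :: "nat \<Rightarrow> nat \<Rightarrow> nat multiset set" where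
  "box a l = {p. size p = l \<and> (\<forall>x\<in>#p. x \<le> a)}"

lemma level_finite_box: "level_finite (box a l)"
  unfolding box_def by (rule level_finite_size)

text \<open>Used with \<open>d = 1\<close> to delete the first column of a diagram, and with
  \<open>d = Suc k\<close> to normalise parts larger than \<open>k\<close>.\<close>

lemma bij_betw_image_mset_add:
  "bij_betw (image_mset (\<lambda>x. x + d)) {p. P (image_mset (\<lambda>x. x + d) p)}
    {p. (\<forall>x\<in>#p. d \<le> x) \<and> P (p :: nat multiset)}"
proof (rule bij_betw_byWitness[where f' = "image_mset (\<lambda>x. x - d)"])
  have *: "image_mset (\<lambda>x. x + d) (image_mset (\<lambda>x. x - d) p) = p" if "\<forall>x\<in>#p. d \<le> x" for p
    using that by (induction p) auto
  then show "\<forall>p\<in>{p. (\<forall>x\<in>#p. d \<le> x) \<and> P p}. image_mset (\<lambda>x. x + d) (image_mset (\<lambda>x. x - d) p) = p"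
    by auto
  show "image_mset (\<lambda>x. x - d) ` {p. (\<forall>x\<in>#p. d \<le> x) \<and> P p} \<subseteq> {p. P (image_mset (\<lambda>x. x + d) p)}"
    using * by auto
qed (auto simp: multiset.map_comp comp_def)

text \<open>
  Here \<open>0\<close> counts as an element, so these are the partitions into at most \<open>e\<close> parts.
\<close>

lemma gf_size: "gf {p. size p = e} = gf_le e"
proof (induction e)
  case 0
  then show ?case by (simp add: gf_le_0 gf_empty)
next
  case (Suc e)
  \<comment> \<open>Either 0 occurs and one copy is deleted, or 1 is subtracted from all
    \<open>Suc e\<close> entries. The result is the recurrence \<open>gf_le_Suc\<close>.\<close>
  let ?z = "{p :: nat multiset. 0 \<in># p \<and> size p = Suc e}"
  let ?n = "{p :: nat multiset. (\<forall>x\<in>#p. 1 \<le> x) \<and> size p = Suc e}"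
  have fin: "level_finite ?z" "level_finite ?n"
    by (rule level_finite_subset[OF level_finite_size[of "Suc e" "\<lambda>_. True"]]; auto)+
  have "{p :: nat multiset. size p = Suc e} = ?z \<union> ?n"
    by (auto simp: Suc_le_eq intro: gr0I)
  moreover have "?z \<inter> ?n = {}"
    by auto
  moreover have "gf ?z = gf {p. size p = e}"
    using gf_bij[OF bij_betw_add_mset[of 0 "\<lambda>p. size p = Suc e"], of 0] by simp
  moreover have "gf ?n = fps_X ^ Suc e * gf {p. size p = Suc e}"
    using gf_bij[OF bij_betw_image_mset_add[of 1 "\<lambda>p. size p = Suc e"], of "Suc e"]
      sum_mset_image_add[of 1]
    by simp
  ultimately have "gf {p. size p = Suc e} = gf_le e + fps_X ^ Suc e * gf {p. size p = Suc e}"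
    using gf_Un[OF fin] Suc by simp
  then have "(1 - fps_X ^ Suc e) * gf {p. size p = Suc e} = (1 - fps_X ^ Suc e) * gf_le (Suc e)"
    unfolding gf_le_Suc unfolding left_diff_distrib mult_1 diff_eq_eq .
  moreover have "1 - fps_X ^ Suc e \<noteq> (0 :: int fps)"
  proof
    assume "1 - fps_X ^ Suc e = (0 :: int fps)"
    then have "fps_nth (1 - fps_X ^ Suc e :: int fps) 0 = fps_nth 0 0"
      by (rule arg_cong)
    then show False by (simp add: fps_X_power_nth del: power_Suc)
  qed
  ultimately show ?case
    by (simp del: power_Suc)
qed

section \<open>Ranks\<close>

lemma gf_box_0_left: "gf (box 0 l) = 1"
proof -
  have "p = replicate_mset (size p) 0" if "\<forall>x\<in>#p. x = (0::nat)" for p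
    using that by (induction p) auto
  then have "box 0 l = {replicate_mset l 0}"
    by (auto simp: box_def split: if_splits)
  then have "gf (box 0 l) = fps_X ^ 0 * gf {{#}}"
    by (intro gf_bij[where f = "\<lambda>_. replicate_mset l 0"]) (auto simp: bij_betw_def)
  then show ?thesis
    by (simp add: gf_empty)
qed

lemma gf_box_0_right: "gf (box a 0) = 1"
proof -
  have "box a 0 = {{#}}"
    by (auto simp: box_def)
  then show ?thesis
    by (simp add: gf_empty)
qed

text \<open>First q-Pascal rule: either 0 occurs and one copy is deleted, or 1 is subtracted from
  all \<open>Suc l\<close> entries.\<close>

lemma gf_box_Suc:
  "gf (box (Suc a) (Suc l)) = gf (box (Suc a) l) + fps_X ^ Suc l * gf (box a (Suc l))"
proof -
  let ?P = "\<lambda>p. p \<in> box (Suc a) (Suc l)"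
  have "box (Suc a) (Suc l) = {p. 0 \<in># p \<and> ?P p} \<union> {p. (\<forall>x\<in>#p. 1 \<le> x) \<and> ?P p}"
    by (auto simp: Suc_le_eq intro: gr0I)
  moreover have "gf ({p. 0 \<in># p \<and> ?P p} \<union> {p. (\<forall>x\<in>#p. 1 \<le> x) \<and> ?P p})
      = gf {p. 0 \<in># p \<and> ?P p} + gf {p. (\<forall>x\<in>#p. 1 \<le> x) \<and> ?P p}"
    by (intro gf_Un level_finite_subset[OF level_finite_box[of "Suc a" "Suc l"]]) auto
  moreover have "gf {p. 0 \<in># p \<and> ?P p} = gf (box (Suc a) l)"
    using gf_bij[OF bij_betw_add_mset[of 0 ?P], of 0] by (simp add: box_def)
  moreover have "gf {p. (\<forall>x\<in>#p. 1 \<le> x) \<and> ?P p} = fps_X ^ Suc l * gf (box a (Suc l))"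
    using gf_bij[OF bij_betw_image_mset_add[of 1 ?P], of "Suc l"] sum_mset_image_add[of 1]
    by (simp add: box_def)
  ultimately show ?thesis
    by simp
qed

text \<open>Second q-Pascal rule, splitting on whether the largest admissible entry
  \<open>Suc a\<close> occurs.\<close>

lemma gf_box_Suc':
  "gf (box (Suc a) (Suc l)) = fps_X ^ Suc a * gf (box (Suc a) l) + gf (box a (Suc l))"
proof -
  let ?P = "\<lambda>p. p \<in> box (Suc a) (Suc l)"
  have "box (Suc a) (Suc l) = {p. Suc a \<in># p \<and> ?P p} \<union> box a (Suc l)"
    by (auto simp: box_def le_Suc_eq)
  moreover have "gf ({p. Suc a \<in># p \<and> ?P p} \<union> box a (Suc l))
      = gf {p. Suc a \<in># p \<and> ?P p} + gf (box a (Suc l))"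
    by (intro gf_Un level_finite_subset[OF level_finite_box[of "Suc a" "Suc l"]])
      (auto simp: box_def)
  moreover have "gf {p. Suc a \<in># p \<and> ?P p} = fps_X ^ Suc a * gf (box (Suc a) l)"
    using gf_bij[OF bij_betw_add_mset[of "Suc a" ?P], of "Suc a"] by (simp add: box_def)
  ultimately show ?thesis
    by simp
qed

text \<open>Swapping \<open>a\<close> and \<open>l\<close> exchanges the two q-Pascal rules, so
  expanding one side by each makes the terms match. This takes the place of conjugating
  diagrams.\<close>

lemma gf_box_sym: "gf (box a l) = gf (box l a)"
proof (induction "a + l" arbitrary: a l rule: less_induct)
  case less
  show ?case
  proof (cases "a = 0 \<or> l = 0")
    case True
    then show ?thesis
      by (auto simp: gf_box_0_left gf_box_0_right)
  next
    case False
    then obtain a' l' where [simp]: "a = Suc a'" "l = Suc l'"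
      by (meson not0_implies_Suc)
    have "gf (box a l) = gf (box a l') + fps_X ^ l * gf (box a' l)"
      using gf_box_Suc by simp
    also have "\<dots> = gf (box l' a) + fps_X ^ l * gf (box l a')"
      using less[of a l'] less[of a' l] by simp
    also have "\<dots> = gf (box l a)"
      using gf_box_Suc'[of l' a'] by simp
    finally show ?thesis .
  qed
qed

section \<open>Symmetry of the rank\<close>

text \<open>Both indices are shifted by one: the rank is still \<open>a - l\<close>, and removing
  the first row and column leaves exactly \<open>box a l\<close>.\<close>

definition max_size :: "nat \<Rightarrow> nat \<Rightarrow> nat multiset set" where
  "max_size a l = {p. 0 \<notin># p \<and> p \<noteq> {#} \<and> largest_part p = Suc a \<and> size p = Suc l}"

lemma largest_part_eq_iff:
  "p \<noteq> {#} \<Longrightarrow> largest_part p = a \<longleftrightarrow> a \<in># p \<and> (\<forall>x\<in>#p. x \<le> a)"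
  unfolding largest_part_def by (subst Max_eq_iff) auto

lemma largest_part_le_iff: "p \<noteq> {#} \<Longrightarrow> largest_part p \<le> a \<longleftrightarrow> (\<forall>x\<in>#p. x \<le> a)"
  unfolding largest_part_def by (subst Max_le_iff) auto

text \<open>Delete one part \<open>Suc a\<close>, then subtract 1 from each of the other
  \<open>l\<close> parts.\<close>

lemma gf_max_size: "gf (max_size a l) = fps_X ^ (a + l + 1) * gf (box a l)"
proof -
  let ?P = "\<lambda>p. 0 \<notin># p \<and> size p = Suc l \<and> (\<forall>x\<in>#p. x \<le> Suc a)"
  let ?R = "\<lambda>p. size p = l \<and> (\<forall>x\<in>#p. x \<le> Suc a)"
  have "max_size a l = {p. Suc a \<in># p \<and> ?P p}"
  proof (rule set_eqI)
    show "p \<in> max_size a l \<longleftrightarrow> p \<in> {p. Suc a \<in># p \<and> ?P p}" for p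
      by (cases "p = {#}") (auto simp: max_size_def largest_part_eq_iff)
  qed
  also have "gf \<dots> = fps_X ^ Suc a * gf {p. (\<forall>x\<in>#p. 1 \<le> x) \<and> ?R p}"
    using gf_bij[OF bij_betw_add_mset[of "Suc a" ?P], of "Suc a"]
    by (simp add: Suc_le_eq conj_ac del: power_Suc) (metis gr0I less_numeral_extra(3))
  also have "gf {p. (\<forall>x\<in>#p. 1 \<le> x) \<and> ?R p} = fps_X ^ l * gf (box a l)"
    using gf_bij[OF bij_betw_image_mset_add[of 1 ?R], of l] sum_mset_image_add[of 1]
    by (simp add: box_def)
  finally show ?thesis
    by (simp add: power_add mult_ac)
qed

lemma gf_max_size_sym: "gf (max_size a l) = gf (max_size l a)"
  by (simp add: gf_max_size gf_box_sym[of a l] add.commute)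

lemma part_le_sum: "x \<in># p \<Longrightarrow> x \<le> sum_mset (p :: nat multiset)"
  by (metis sum_mset.remove le_add1)

lemma largest_part_in: "p \<noteq> {#} \<Longrightarrow> largest_part p \<in># p"
  using largest_part_eq_iff by blast

text \<open>Partitions are sorted by largest part and size. Both are at most \<open>n\<close>, so
  the bounds on \<open>a\<close> and \<open>l\<close> lose nothing and keep the sum finite.\<close>

lemma card_rank:
  assumes "n > 0"
  shows "int (card {p \<in> partitions_of n. partition_rank p = m})
    = (\<Sum>(a, l) | a \<le> n \<and> l \<le> n \<and> int a - int l = m. fps_nth (gf (max_size a l)) n)"
proof -
  let ?I = "{(a, l). a \<le> n \<and> l \<le> n \<and> int a - int l = m}"
  let ?F = "\<lambda>(a, l). {p \<in> max_size a l. sum_mset p = n}"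
  have fin: "finite (?F x)" for x
    by (rule finite_subset[OF _ finite_partitions_of[of n]])
      (auto simp: max_size_def partitions_of_def split: prod.splits)
  have "finite ?I"
    by (rule finite_subset[of _ "{..n} \<times> {..n}"]) auto
  moreover have "{p \<in> partitions_of n. partition_rank p = m} = (\<Union>x\<in>?I. ?F x)"
  proof (intro equalityI subsetI)
    fix p
    assume p: "p \<in> {p \<in> partitions_of n. partition_rank p = m}"
    then have ne: "p \<noteq> {#}" and 0: "0 \<notin># p"
      using assms by (auto simp: partitions_of_def)
    have "largest_part p \<in># p" "largest_part p \<le> n" "size p \<le> n"
      using p largest_part_in[OF ne] part_le_sum size_le_sum_mset[of p]
      by (auto simp: partitions_of_def)
    moreover obtain a l where al: "largest_part p = Suc a" "size p = Suc l"
      using ne 0 \<open>largest_part p \<in># p\<close> by (metis not0_implies_Suc size_eq_0_iff_empty)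
    ultimately have "(a, l) \<in> ?I" "p \<in> ?F (a, l)"
      using p ne by (auto simp: partitions_of_def partition_rank_def max_size_def)
    then show "p \<in> (\<Union>x\<in>?I. ?F x)"
      by blast
  qed (auto simp: partitions_of_def partition_rank_def max_size_def)
  moreover have "card (\<Union>x\<in>?I. ?F x) = (\<Sum>x\<in>?I. card (?F x))"
    using \<open>finite ?I\<close> fin by (intro card_UN_disjoint) (auto simp: max_size_def)
  ultimately show ?thesis
    by (simp add: gf_nth case_prod_unfold)
qed

text \<open>Swapping \<open>a\<close> and \<open>l\<close> in \<open>card_rank\<close> negates the
  rank and preserves each summand.\<close>

lemma rank_sym:
  assumes "n > 0"
  shows "card {p \<in> partitions_of n. partition_rank p = - m} = card {p \<in> partitions_of n. partition_rank p = m}"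
proof -
  have "int (card {p \<in> partitions_of n. partition_rank p = - m})
      = int (card {p \<in> partitions_of n. partition_rank p = m})"
    unfolding card_rank[OF assms]
    by (rule sum.reindex_bij_witness[where i = prod.swap and j = prod.swap])
      (auto simp: gf_max_size_sym)
  then show ?thesis
    by simp
qed

lemma N_rank_minus: "N_rank (- m) n = N_rank m n"
  by (simp add: N_rank_def rank_sym)

section \<open>Dyson's adjoint\<close>

lemma filter_pos: "0 \<notin># q \<Longrightarrow> {#x \<in># q. 0 < x#} = (q :: nat multiset)"
  by (auto simp: filter_mset_eq_conv intro: gr0I)

text \<open>
  Dyson's adjoint: delete the first column, of length \<open>l\<close>, of the Young diagram and insert a new
  first row of length \<open>l + r\<close>. Both sides are matched with the multisets \<open>v\<close> of size \<open>l\<close> left after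
  the deletion, in which the zeros are kept so that \<open>l\<close> can be recovered.
\<close>

lemma dyson_adjoint:
  assumes r: "r \<ge> 1"
  shows "card {p \<in> partitions_of (n + r). p \<noteq> {#} \<and> int r - 1 \<le> partition_rank p}
    = card {p \<in> partitions_of n. p = {#} \<or> partition_rank p \<le> int r + 1}"
    (is "card ?G = card ?H")
proof -
  \<comment> \<open>The size of \<open>v\<close> is the length of the deleted column. The bound says
    that the new row is at least as long as the remaining ones.\<close>
  let ?V = "{v. sum_mset v + size v = n \<and> (\<forall>x\<in>#v. x \<le> size v + r)}"
  let ?P = "\<lambda>p. sum_mset p = n \<and> (\<forall>x\<in>#p. x \<le> size p + r + 1)"
  have "?H = {p. (\<forall>x\<in>#p. 1 \<le> x) \<and> ?P p}"
  proof -
    have "p = {#} \<or> partition_rank p \<le> int r + 1 \<longleftrightarrow> (\<forall>x\<in>#p. x \<le> size p + r + 1)" for p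
      using largest_part_le_iff[of p "size p + r + 1"]
      by (cases "p = {#}") (auto simp: partition_rank_def)
    moreover have "0 \<notin># p \<longleftrightarrow> (\<forall>x\<in>#p. 1 \<le> x)" for p :: "nat multiset"
      by (metis gr0I less_one linorder_not_le)
    ultimately show ?thesis
      by (auto simp: partitions_of_def)
  qed
  then have H: "card ?V = card ?H"
    using bij_betw_same_card[OF bij_betw_image_mset_add[of 1 ?P]] sum_mset_image_add[of 1] by simp
  let ?f = "\<lambda>v. add_mset (size v + r) {#x \<in># v. 0 < x#}"
  let ?q = "\<lambda>p. p - {#largest_part p#}"
  \<comment> \<open>The largest part is \<open>l + r\<close>, which recovers \<open>l\<close>; the
    other parts are padded with zeros up to size \<open>l\<close>.\<close>
  let ?g = "\<lambda>p. ?q p + replicate_mset (largest_part p - r - size (?q p)) 0"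
  have part: "{#x \<in># v. 0 < x#} + replicate_mset (size v - size {#x \<in># v. 0 < x#}) 0 = v" for v :: "nat multiset"
  proof -
    have "{#x \<in># v. \<not> 0 < x#} = replicate_mset (count v 0) 0"
      by (simp add: filter_eq_replicate_mset)
    then have v: "v = {#x \<in># v. 0 < x#} + replicate_mset (count v 0) 0"
      using multiset_partition[of v "\<lambda>x. 0 < x"] by simp
    from arg_cong[OF this, of size] have "size v - size {#x \<in># v. 0 < x#} = count v 0"
      by simp
    with v show ?thesis by simp
  qed
  have sumf: "sum_mset {#x \<in># v. 0 < x#} = sum_mset v" for v :: "nat multiset"
    using arg_cong[OF part, of sum_mset v] by simp
  have lf: "largest_part (?f v) = size v + r" if "v \<in> ?V" for v
    using that by (subst largest_part_eq_iff) auto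
  have sf: "size {#x \<in># v. 0 < x#} \<le> size v" for v :: "nat multiset"
    by (rule size_filter_mset_lesseq)
  have "bij_betw ?f ?V ?G"
  proof (rule bij_betw_byWitness[where f' = ?g])
    show "\<forall>v\<in>?V. ?g (?f v) = v"
      using lf part by simp
    show "?f ` ?V \<subseteq> ?G"
    proof (intro image_subsetI)
      fix v assume v: "v \<in> ?V"
      \<comment> \<open>At most \<open>size v\<close> old parts survive, so the rank is at least
        \<open>r - 1\<close>. If \<open>v\<close> is empty, \<open>r \<ge> 1\<close> makes the new
        row nonzero.\<close>
      then show "?f v \<in> ?G"
        using lf[OF v] sf[of v] sumf[of v] r by (auto simp: partitions_of_def partition_rank_def)
    qed
    have g: "?f (?g p) = p \<and> ?g p \<in> ?V" if p: "p \<in> ?G" for p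
    proof -
      have ne: "p \<noteq> {#}" and 0: "0 \<notin># p" and sum: "sum_mset p = n + r"
        using p by (auto simp: partitions_of_def)
      note L = largest_part_in[OF ne]
      have pq: "p = add_mset (largest_part p) (?q p)"
        using L by simp
      have sz: "size p = Suc (size (?q p))"
        using arg_cong[OF pq, of size] by simp
      have sm: "n + r = largest_part p + sum_mset (?q p)"
        using arg_cong[OF pq, of sum_mset] sum by simp
      have q0: "0 \<notin># ?q p"
        using 0 by (meson in_diffD)
      have filt: "{#x \<in># ?q p. 0 < x#} = ?q p"
        by (rule filter_pos[OF q0])
      have le: "size (?q p) + r \<le> largest_part p"
        using p sz by (auto simp: partition_rank_def)
      have szg: "size (?g p) + r = largest_part p"
        using le by simp
      have "{#x \<in># ?g p. 0 < x#} = ?q p"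
        using filt by simp
      then have "?f (?g p) = p"
        using szg pq by simp
      moreover have "sum_mset (?g p) + size (?g p) = n"
        using sm szg by simp
      moreover have "\<forall>x\<in>#?g p. x \<le> largest_part p"
        using largest_part_le_iff[OF ne, of "largest_part p"]
        by (auto simp: in_replicate_mset dest: in_diffD)
      ultimately show ?thesis
        using szg by simp
    qed
    then show "\<forall>p\<in>?G. ?f (?g p) = p" "?g ` ?G \<subseteq> ?V"
      by blast+
  qed
  then have "card ?V = card ?G"
    by (rule bij_betw_same_card)
  then show ?thesis
    using H by (rule trans[OF sym])
qed

section \<open>Cranks\<close>

text \<open>For \<open>k \<ge> 1\<close> all members have crank \<open>e - k\<close>.\<close>

definition ones :: "nat \<Rightarrow> nat \<Rightarrow> nat multiset set" where
  "ones k e = {p. 0 \<notin># p \<and> count p 1 = k \<and> size {#x \<in># p. k < x#} = e}"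

lemma parts_ge_2_iff: "(\<forall>x\<in>#p. 2 \<le> x) \<longleftrightarrow> 0 \<notin># p \<and> 1 \<notin># (p :: nat multiset)"
proof
  assume "0 \<notin># p \<and> 1 \<notin># p"
  then have "x \<noteq> 0 \<and> x \<noteq> 1" if "x \<in># p" for x
    using that by metis
  then show "\<forall>x\<in>#p. 2 \<le> x"
    by (metis One_nat_def less_2_cases not_le)
qed (auto dest: bspec[of _ _ 0] bspec[of _ _ 1])

lemma parts_in_2_iff:
  assumes "count p 1 = 0"
  shows "p \<in> parts_in {2..m} \<longleftrightarrow> 0 \<notin># p \<and> (\<forall>x\<in>#p. x \<le> m)"
proof -
  have "p \<in> parts_in {2..m} \<longleftrightarrow> (\<forall>x\<in>#p. 2 \<le> x) \<and> (\<forall>x\<in>#p. x \<le> m)"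
    by (auto simp: parts_in_def)
  then show ?thesis
    using assms by (simp add: parts_ge_2_iff count_eq_zero_iff)
qed

text \<open>Remove the \<open>k\<close> ones. The parts in \<open>{2..k}\<close> contribute
  \<open>(1 - fps_X) * gf_le k\<close>; the \<open>e\<close> larger parts, each lowered by
  \<open>k + 1\<close>, contribute \<open>gf_le e\<close>. The exponent is
  \<open>k + (k + 1) * e\<close>.\<close>

lemma gf_ones:
  assumes k: "k \<ge> 1"
  shows "gf (ones k e) = (1 - fps_X) * fps_X ^ (k + e + k * e) * gf_le k * gf_le e"
proof -
  let ?B = "{q. size q = e \<and> (\<forall>x\<in>#q. k < x)}"
  let ?C = "{p. 0 \<notin># p \<and> 1 \<notin># p \<and> size {#x \<in># p. k < x#} = e}"
  have C: "{p. {#x \<in># p. x \<in> {..k}#} \<in> parts_in {2..k} \<and> {#x \<in># p. x \<notin> {..k}#} \<in> ?B} = ?C"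
  proof (rule set_eqI)
    fix p
    have "set_mset {#x \<in># p. x \<in> {..k}#} \<subseteq> {2..k} \<longleftrightarrow> (\<forall>x\<in>#p. x \<le> k \<longrightarrow> 2 \<le> x)"
      by auto
    \<comment> \<open>Entries larger than \<open>k\<close> are at least 2 because
      \<open>k \<ge> 1\<close>.\<close>
    also have "\<dots> \<longleftrightarrow> (\<forall>x\<in>#p. 2 \<le> x)"
      using k by (intro ball_cong refl) auto
    finally have "set_mset {#x \<in># p. x \<in> {..k}#} \<subseteq> {2..k} \<longleftrightarrow> 0 \<notin># p \<and> 1 \<notin># p"
      unfolding parts_ge_2_iff .
    then show "p \<in> {p. {#x \<in># p. x \<in> {..k}#} \<in> parts_in {2..k} \<and> {#x \<in># p. x \<notin> {..k}#} \<in> ?B}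
        \<longleftrightarrow> p \<in> ?C"
      by (simp add: parts_in_def not_le)
  qed
  have "gf ?C = gf (parts_in {2..k}) * gf ?B"
    unfolding C[symmetric]
  proof (rule gf_mult)
    show "level_finite (parts_in {2..k})"
      by (rule level_finite_parts_in) simp
    show "level_finite ?B"
      by (rule level_finite_size)
  qed (auto simp: parts_in_def)
  also have "gf ?B = fps_X ^ (Suc k * e) * gf {q. size q = e}"
    using gf_bij[OF bij_betw_image_mset_add[of "Suc k" "\<lambda>q. size q = e"], of "Suc k * e"]
      sum_mset_image_add[of "Suc k"]
    by (simp add: conj_commute Suc_le_eq)
  finally have gf_C: "gf ?C = gf (parts_in {2..k}) * (fps_X ^ (Suc k * e) * gf {q. size q = e})" .
  have "gf (ones k e) = fps_X ^ k * gf ?C"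
  proof (rule gf_bij)
    show "bij_betw (\<lambda>p. p + replicate_mset k 1) ?C (ones k e)"
    proof (rule bij_betw_byWitness[where f' = "\<lambda>p. p - replicate_mset k 1"])
      have sub: "replicate_mset k 1 \<subseteq># p" if "p \<in> ones k e" for p
        using that by (simp add: ones_def flip: count_le_replicate_mset_subset_eq)
      have restore: "p - replicate_mset k 1 + replicate_mset k 1 = p" if "p \<in> ones k e" for p
        using sub[OF that] by (rule subset_mset.diff_add)
      show "\<forall>p\<in>ones k e. p - replicate_mset k 1 + replicate_mset k 1 = p"
        using restore by blast
      show "(\<lambda>p. p - replicate_mset k 1) ` ones k e \<subseteq> ?C"
      proof (intro image_subsetI)
        fix p assume p: "p \<in> ones k e"
        let ?p = "p - replicate_mset k 1"
        have "{#x \<in># ?p + replicate_mset k 1. k < x#} = {#x \<in># ?p. k < x#}"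
          using k by simp
        then have eq: "{#x \<in># p. k < x#} = {#x \<in># ?p. k < x#}"
          unfolding restore[OF p] .
        have "size {#x \<in># p. k < x#} = e"
          using p by (simp add: ones_def)
        then have "size {#x \<in># ?p. k < x#} = e"
          unfolding eq .
        moreover have "count ?p 1 = 0"
          using p by (simp add: ones_def)
        moreover have "0 \<notin># ?p"
          using p by (auto simp: ones_def dest: in_diffD)
        ultimately show "?p \<in> ?C"
          by (simp add: not_in_iff)
      qed
      show "\<forall>p\<in>?C. p + replicate_mset k 1 - replicate_mset k 1 = p"
        by simp
      show "(\<lambda>p. p + replicate_mset k 1) ` ?C \<subseteq> ones k e"
        using k by (auto simp: ones_def not_in_iff in_replicate_mset)
    qed
  qed simp
  then show ?thesis
    unfolding gf_C using k by (simp add: gf_parts_in_2 gf_size power_add power_mult mult_ac)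
qed

lemma gf_ones_sym: "k \<ge> 1 \<Longrightarrow> e \<ge> 1 \<Longrightarrow> gf (ones k e) = gf (ones e k)"
  by (simp add: gf_ones mult_ac add_ac)

text \<open>Fills the gap of \<open>gf_ones_sym\<close> at \<open>e = 0\<close>: there the
  counterpart consists of partitions without ones, whose crank is the largest part.\<close>

lemma gf_ones_0: "k \<ge> 1 \<Longrightarrow> gf (ones k 0) = fps_X ^ k * gf (parts_in {2..k})"
  by (simp add: gf_ones gf_parts_in_2 gf_le_0 mult_ac)

text \<open>
  \<open>few_large i j\<close> is the generating function of the partitions with at most \<open>i\<close> parts larger than \<open>j\<close>,
  that is, those whose diagram does not contain the \<open>(i + 1) \<times> (j + 1)\<close> rectangle. Conjugation makes it
  symmetric in \<open>i\<close> and \<open>j\<close>; the proof of this below is by recurrences.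
\<close>

definition few_large :: "nat \<Rightarrow> nat \<Rightarrow> int fps" where
  "few_large i j = (\<Sum>e\<le>i. gf_le j * fps_X ^ (e * Suc j) * gf_le e)"

lemma few_large_Suc:
  "few_large (Suc i) j = few_large i j + gf_le j * fps_X ^ (Suc i * Suc j) * gf_le (Suc i)"
  by (simp add: few_large_def)

lemma few_large_0_right: "few_large i 0 = gf_le i"
proof (induction i)
  case (Suc i)
  then show ?case
    using gf_le_Suc[of i] by (simp add: few_large_Suc gf_le_0 algebra_simps)
qed (simp add: few_large_def gf_le_0)

text \<open>Mirror image of \<open>few_large_Suc\<close>. The added term counts the partitions whose
  \<open>(i + 1)\<close>-st largest part is exactly \<open>j + 1\<close>.\<close>

lemma few_large_Suc':
  "few_large i (Suc j) = few_large i j + gf_le i * fps_X ^ (Suc i * Suc j) * gf_le (Suc j)"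
proof (induction i)
  case 0
  then show ?case
    using gf_le_Suc[of j] by (simp add: few_large_def gf_le_0 algebra_simps)
next
  case (Suc i)
  define u v where "u = (fps_X ^ Suc i :: int fps)" and "v = (fps_X ^ Suc j :: int fps)"
  define w where "w = (fps_X ^ (Suc i * Suc j) :: int fps)"
  have pow: "fps_X ^ (Suc i * Suc (Suc j)) = w * u" "fps_X ^ (Suc (Suc i) * Suc j) = w * v"
    unfolding u_def v_def w_def power_add[symmetric] by (simp_all add: algebra_simps)
  have gf_le: "gf_le i = (1 - u) * gf_le (Suc i)" "gf_le j = (1 - v) * gf_le (Suc j)"
    using gf_le_Suc[of i] gf_le_Suc[of j] by (simp_all add: u_def v_def)
  have "few_large (Suc i) (Suc j)
      = few_large i j + gf_le i * w * gf_le (Suc j) + gf_le (Suc j) * (w * u) * gf_le (Suc i)"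
    unfolding few_large_Suc Suc pow w_def ..
  \<comment> \<open>Both pairs of correction terms add up to
    \<open>w * gf_le (Suc i) * gf_le (Suc j)\<close>.\<close>
  also have "\<dots> = few_large i j + gf_le j * w * gf_le (Suc i) + gf_le (Suc i) * (w * v) * gf_le (Suc j)"
    unfolding gf_le by (simp add: algebra_simps)
  finally show ?case
    unfolding few_large_Suc pow w_def .
qed

lemma few_large_sym: "few_large i j = few_large j i"
proof (induction j)
  case 0
  then show ?case by (simp add: few_large_0_right) (simp add: few_large_def gf_le_0)
next
  case (Suc j)
  then show ?case
    by (simp add: few_large_Suc few_large_Suc' mult_ac)
qed

lemma sum_gf_ones: "k \<ge> 1 \<Longrightarrow> (\<Sum>e\<le>i. gf (ones k e)) = (1 - fps_X) * fps_X ^ k * few_large i k"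
  by (simp add: gf_ones few_large_def sum_distrib_left power_add power_mult mult_ac)

text \<open>The symmetry of \<open>few_large\<close> at \<open>k\<close> and \<open>k + m\<close>.
  It relates cranks at most \<open>-m\<close> to cranks at most \<open>m\<close> among partitions
  with ones.\<close>

lemma sum_gf_ones_shift:
  assumes "k \<ge> 1"
  shows "(\<Sum>e\<le>k. gf (ones (k + m) e)) = fps_X ^ m * (\<Sum>e\<le>k + m. gf (ones k e))"
  using assms by (simp add: sum_gf_ones few_large_sym[of k] power_add mult_ac)

section \<open>Adjoint and symmetry of the crank\<close>

lemma card_ones_UN:
  assumes "finite I"
  shows "int (card {p. (count p 1, size {#x \<in># p. count p 1 < x#}) \<in> I \<and> p \<in> partitions_of n})
    = (\<Sum>(k, e)\<in>I. fps_nth (gf (ones k e)) n)"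
proof -
  let ?F = "\<lambda>(k, e). {p \<in> ones k e. sum_mset p = n}"
  have "{p. (count p 1, size {#x \<in># p. count p 1 < x#}) \<in> I \<and> p \<in> partitions_of n} = (\<Union>x\<in>I. ?F x)"
    by (auto simp: ones_def partitions_of_def)
  moreover have "finite (?F x)" for x
    by (rule finite_subset[OF _ finite_partitions_of[of n]])
      (auto simp: ones_def partitions_of_def split: prod.splits)
  then have "card (\<Union>x\<in>I. ?F x) = (\<Sum>x\<in>I. card (?F x))"
    using assms by (intro card_UN_disjoint) (auto simp: ones_def)
  ultimately show ?thesis
    by (simp add: gf_nth case_prod_unfold)
qed

lemma count_le_sum: "count p 1 \<le> sum_mset (p :: nat multiset)"
  by (induction p) auto

lemma crank_with_ones:
  "count p 1 > 0 \<Longrightarrow> partition_crank p = int (size {#x \<in># p. count p 1 < x#}) - int (count p 1)"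
  by (simp add: partition_crank_def Let_def del: count_greater_zero_iff)

lemma crank_no_ones: "count p 1 = 0 \<Longrightarrow> partition_crank p = int (largest_part p)"
  by (simp add: partition_crank_def Let_def)

text \<open>On the left there are \<open>k + m\<close> ones and at most \<open>k\<close> larger
  parts. For \<open>k \<ge> 1\<close>, \<open>sum_gf_ones_shift\<close> leads to \<open>k\<close>
  ones and at most \<open>k + m\<close> larger parts. For \<open>k = 0\<close>, deleting the
  \<open>m\<close> ones leaves parts in \<open>{2..m}\<close>: the case without ones, including the
  empty partition.\<close>

lemma crank_adjoint:
  assumes m: "m \<ge> 1"
  shows "card {p \<in> partitions_of (n + m). p \<noteq> {#} \<and> partition_crank p \<le> - int m}
    = card {p \<in> partitions_of n. p = {#} \<or> partition_crank p \<le> int m}"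
    (is "card ?L = card ?R")
proof -
  \<comment> \<open>The pairs (number of ones, number of larger parts) with crank at most
    \<open>-m\<close> in \<open>I\<close>, and at most \<open>m\<close> in \<open>J\<close>.\<close>
  define I where "I = (\<lambda>(k, e). (k + m, e)) ` (SIGMA k:{..n}. {..k})"
  define J where "J = (SIGMA k:{1..n}. {..k + m})"
  have fin: "finite I" "finite J"
    by (simp_all add: I_def J_def)
  let ?ke = "\<lambda>p. (count p 1, size {#x \<in># p. count p 1 < x#})"
  have "?L = {p. ?ke p \<in> I \<and> p \<in> partitions_of (n + m)}"
  proof (rule Collect_cong)
    fix p
    show "p \<in> partitions_of (n + m) \<and> p \<noteq> {#} \<and> partition_crank p \<le> - int m
        \<longleftrightarrow> ?ke p \<in> I \<and> p \<in> partitions_of (n + m)"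
    proof (cases "p \<in> partitions_of (n + m)")
      case True
      then have le: "count p 1 \<le> n + m" and ne: "p \<noteq> {#}"
        using count_le_sum[of p] m by (auto simp: partitions_of_def)
      have I: "(k, e) \<in> I \<longleftrightarrow> k \<ge> m \<and> k - m \<le> n \<and> e \<le> k - m" for k e
        unfolding I_def by (force simp: image_iff intro: bexI[of _ "(k - m, e)"])
      show ?thesis
      proof (cases "count p 1 = 0")
        case True
        then show ?thesis
          using m by (simp add: I crank_no_ones)
      next
        case False
        then have "partition_crank p \<le> - int m \<longleftrightarrow> ?ke p \<in> I"
          using le by (auto simp: I crank_with_ones)
        then show ?thesis
          using True ne by blast
      qed
    qed simp
  qed
  then have "int (card ?L) = (\<Sum>(k, e)\<in>I. fps_nth (gf (ones k e)) (n + m))"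
    using card_ones_UN[OF fin(1)] by simp
  also have "\<dots> = (\<Sum>(k, e)\<in>(SIGMA k:{..n}. {..k}). fps_nth (gf (ones (k + m) e)) (n + m))"
    unfolding I_def by (subst sum.reindex) (auto simp: inj_on_def case_prod_unfold)
  also have "\<dots> = (\<Sum>k\<le>n. fps_nth (\<Sum>e\<le>k. gf (ones (k + m) e)) (n + m))"
    by (subst sum.Sigma[symmetric]) (auto simp: fps_sum_nth)
  also have "\<dots> = fps_nth (gf (ones m 0)) (n + m)
      + (\<Sum>k\<in>{1..n}. fps_nth (\<Sum>e\<le>k. gf (ones (k + m) e)) (n + m))"
    by (simp add: atMost_atLeast0 sum.atLeast_Suc_atMost)
  also have "fps_nth (gf (ones m 0)) (n + m) = fps_nth (gf (parts_in {2..m})) n"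
    using m by (simp add: gf_ones_0 fps_X_power_mult_nth)
  also have "(\<Sum>k\<in>{1..n}. fps_nth (\<Sum>e\<le>k. gf (ones (k + m) e)) (n + m))
      = (\<Sum>k\<in>{1..n}. fps_nth (\<Sum>e\<le>k + m. gf (ones k e)) n)"
    by (intro sum.cong refl) (simp add: sum_gf_ones_shift fps_X_power_mult_nth)
  also have "\<dots> = (\<Sum>(k, e)\<in>J. fps_nth (gf (ones k e)) n)"
    unfolding J_def by (subst sum.Sigma[symmetric]) (auto simp: fps_sum_nth)
  also have "\<dots> = int (card {p. ?ke p \<in> J \<and> p \<in> partitions_of n})"
    by (rule card_ones_UN[OF fin(2), symmetric])
  also have "fps_nth (gf (parts_in {2..m})) n + \<dots>
      = int (card ({p \<in> parts_in {2..m}. sum_mset p = n} \<union> {p. ?ke p \<in> J \<and> p \<in> partitions_of n}))"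
  proof (subst card_Un_disjoint)
    show "finite {p \<in> parts_in {2..m}. sum_mset p = n}"
      using level_finite_parts_in[of "{2..m}"] by (simp add: level_finite_def)
    show "finite {p. ?ke p \<in> J \<and> p \<in> partitions_of n}"
      using finite_partitions_of[of n] by (rule finite_subset[rotated]) auto
    show "{p \<in> parts_in {2..m}. sum_mset p = n} \<inter> {p. ?ke p \<in> J \<and> p \<in> partitions_of n} = {}"
    proof -
      have "?ke p \<notin> J" if "p \<in> parts_in {2..m}" for p
      proof -
        have "count p 1 = 0"
          using that by (auto simp: parts_in_def count_eq_zero_iff)
        then show ?thesis
          by (auto simp: J_def)
      qed
      then show ?thesis
        by blast
    qed
  qed (simp add: gf_nth)
  also have "{p \<in> parts_in {2..m}. sum_mset p = n} \<union> {p. ?ke p \<in> J \<and> p \<in> partitions_of n} = ?R"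
  proof (rule set_eqI)
    fix p
    show "p \<in> {p \<in> parts_in {2..m}. sum_mset p = n} \<union> {p. ?ke p \<in> J \<and> p \<in> partitions_of n}
      \<longleftrightarrow> p \<in> ?R"
    proof (cases "count p 1 = 0")
      case True
      have "p \<in> parts_in {2..m} \<longleftrightarrow> 0 \<notin># p \<and> (\<forall>x\<in>#p. x \<le> m)"
        using True by (rule parts_in_2_iff)
      moreover have "p = {#} \<or> partition_crank p \<le> int m \<longleftrightarrow> (\<forall>x\<in>#p. x \<le> m)"
        using largest_part_le_iff[of p m] crank_no_ones[OF True] by (cases "p = {#}") auto
      moreover have "?ke p \<notin> J"
        using True by (simp add: J_def image_iff)
      ultimately show ?thesis
        by (auto simp: partitions_of_def)
    next
      case False
      then have "p \<notin> parts_in {2..m}" "p \<noteq> {#}"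
        by (auto simp: parts_in_def simp flip: not_in_iff)
      then show ?thesis
        using False count_le_sum[of p] by (auto simp: J_def partitions_of_def crank_with_ones)
    qed
  qed
  finally show ?thesis
    by simp
qed

text \<open>As in \<open>crank_adjoint\<close>, but with exact cranks: \<open>gf_ones_sym\<close>
  exchanges \<open>k + m\<close> ones and \<open>k\<close> larger parts for
  \<open>k \<ge> 1\<close>, and \<open>k = 0\<close> is matched with largest part \<open>m\<close>
  and no ones.\<close>

lemma crank_sym_pos:
  assumes n: "n \<ge> 2" and m: "m \<ge> 1"
  shows "card {p \<in> partitions_of n. partition_crank p = - int m}
    = card {p \<in> partitions_of n. partition_crank p = int m}"
    (is "card ?L = card ?R")
proof -
  define I where "I = (\<lambda>k. (k + m, k)) ` {..n}"
  define J where "J = (\<lambda>k. (k, k + m)) ` {1..n}"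
  let ?A = "{p. m \<in># p \<and> p \<in> parts_in {2..m}}"
  have fin: "finite I" "finite J"
    by (simp_all add: I_def J_def)
  let ?ke = "\<lambda>p. (count p 1, size {#x \<in># p. count p 1 < x#})"
  \<comment> \<open>For \<open>m \<ge> 2\<close> the \<open>m\<close> ones are traded for a single
    part \<open>m\<close>. For \<open>m = 1\<close> the series are \<open>fps_X\<close> and 0, which
    agree from \<open>n = 2\<close> on.\<close>
  have A: "fps_nth (gf (ones m 0)) n = fps_nth (gf ?A) n"
  proof (cases "m = 1")
    case True
    then have "?A = {}" and "parts_in {2..m} = {{#}}"
      by (auto simp: parts_in_def)
    then show ?thesis
      using True n gf_ones_0[of 1] by (simp add: gf_empty gf_nth)
  next
    case False
    then have "gf ?A = fps_X ^ m * gf (parts_in {2..m})"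
      using gf_bij[OF bij_betw_add_mset[of m "\<lambda>p. p \<in> parts_in {2..m}"], of m] m
      by (simp add: parts_in_def)
    then show ?thesis
      using m by (simp add: gf_ones_0)
  qed
  have "?L = {p. ?ke p \<in> I \<and> p \<in> partitions_of n}"
  proof (rule Collect_cong)
    fix p
    have I: "(k, e) \<in> I \<longleftrightarrow> k = e + m \<and> e \<le> n" for k e
      by (auto simp: I_def)
    have "p \<in> partitions_of n \<Longrightarrow> partition_crank p = - int m \<longleftrightarrow> ?ke p \<in> I"
      using m count_le_sum[of p]
      by (cases "count p 1 = 0") (auto simp: I partitions_of_def crank_with_ones crank_no_ones)
    then show "p \<in> partitions_of n \<and> partition_crank p = - int m
        \<longleftrightarrow> ?ke p \<in> I \<and> p \<in> partitions_of n"
      by blast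
  qed
  then have "int (card ?L) = (\<Sum>(k, e)\<in>I. fps_nth (gf (ones k e)) n)"
    using card_ones_UN[OF fin(1)] by simp
  also have "\<dots> = (\<Sum>k\<le>n. fps_nth (gf (ones (k + m) k)) n)"
    unfolding I_def by (subst sum.reindex) (auto simp: inj_on_def)
  also have "\<dots> = fps_nth (gf (ones m 0)) n + (\<Sum>k\<in>{1..n}. fps_nth (gf (ones (k + m) k)) n)"
    by (simp add: atMost_atLeast0 sum.atLeast_Suc_atMost)
  also have "(\<Sum>k\<in>{1..n}. fps_nth (gf (ones (k + m) k)) n) = (\<Sum>k\<in>{1..n}. fps_nth (gf (ones k (k + m))) n)"
    by (intro sum.cong refl arg_cong2[where f = fps_nth] gf_ones_sym) auto
  also have "\<dots> = (\<Sum>(k, e)\<in>J. fps_nth (gf (ones k e)) n)"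
    unfolding J_def by (subst sum.reindex) (auto simp: inj_on_def)
  also have "\<dots> = int (card {p. ?ke p \<in> J \<and> p \<in> partitions_of n})"
    by (rule card_ones_UN[OF fin(2), symmetric])
  also have "fps_nth (gf (ones m 0)) n + \<dots>
      = int (card ({p \<in> ?A. sum_mset p = n} \<union> {p. ?ke p \<in> J \<and> p \<in> partitions_of n}))"
    unfolding A
  proof (subst card_Un_disjoint)
    show "finite {p \<in> ?A. sum_mset p = n}"
      using level_finite_subset[OF level_finite_parts_in[of "{2..m}"], of ?A]
      by (auto simp: level_finite_def)
    show "finite {p. ?ke p \<in> J \<and> p \<in> partitions_of n}"
      using finite_partitions_of[of n] by (rule finite_subset[rotated]) auto
    show "{p \<in> ?A. sum_mset p = n} \<inter> {p. ?ke p \<in> J \<and> p \<in> partitions_of n} = {}"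
    proof -
      have "?ke p \<notin> J" if "p \<in> parts_in {2..m}" for p
      proof -
        have "count p 1 = 0"
          using that by (auto simp: parts_in_def count_eq_zero_iff)
        then show ?thesis
          by (auto simp: J_def)
      qed
      then show ?thesis
        by blast
    qed
  qed (simp add: gf_nth)
  also have "{p \<in> ?A. sum_mset p = n} \<union> {p. ?ke p \<in> J \<and> p \<in> partitions_of n} = ?R"
  proof (rule set_eqI)
    fix p
    show "p \<in> {p \<in> ?A. sum_mset p = n} \<union> {p. ?ke p \<in> J \<and> p \<in> partitions_of n} \<longleftrightarrow> p \<in> ?R"
    proof (cases "count p 1 = 0")
      case True
      have "p \<in> parts_in {2..m} \<longleftrightarrow> 0 \<notin># p \<and> (\<forall>x\<in>#p. x \<le> m)"
        using True by (rule parts_in_2_iff)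
      moreover have "p \<noteq> {#} \<Longrightarrow> partition_crank p = int m \<longleftrightarrow> m \<in># p \<and> (\<forall>x\<in>#p. x \<le> m)"
        using largest_part_eq_iff[of p m] crank_no_ones[OF True] by auto
      moreover have "p \<noteq> {#}" if "p \<in> partitions_of n"
        using that n by (auto simp: partitions_of_def)
      moreover have "?ke p \<notin> J"
        using True by (simp add: J_def image_iff)
      ultimately show ?thesis
        by (auto simp: partitions_of_def)
    next
      case False
      then have "p \<notin> parts_in {2..m}"
        by (auto simp: parts_in_def simp flip: not_in_iff)
      then show ?thesis
        using False count_le_sum[of p] by (auto simp: J_def partitions_of_def crank_with_ones)
    qed
  qed
  finally show ?thesis
    by simp
qed

section \<open>The common recurrence\<close>

text \<open>The parts divisible by 3 and the other parts vary independently. Dividing the former by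
  3 gives an arbitrary partition of \<open>k\<close>.\<close>

lemma partitions_conv_p3:
  "int (card (partitions_of n)) = (\<Sum>k | 3 * k \<le> n. int (card (partitions_of k)) * int (p3 (n - 3 * k)))"
proof -
  let ?A = "parts_in {x. x > 0 \<and> 3 dvd x}"
  let ?B = "parts_in {x. \<not> 3 dvd x}"
  have "{p. {#x \<in># p. x \<in> {x. 3 dvd x}#} \<in> ?A \<and> {#x \<in># p. x \<notin> {x. 3 dvd x}#} \<in> ?B} = {p. 0 \<notin># p}"
    by (auto simp: parts_in_def intro: gr0I)
  moreover have "gf {p. {#x \<in># p. x \<in> {x. 3 dvd x}#} \<in> ?A \<and> {#x \<in># p. x \<notin> {x. 3 dvd x}#} \<in> ?B} = gf ?A * gf ?B"
  proof (rule gf_mult)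
    show "level_finite ?A" "level_finite ?B"
      by (rule level_finite_parts_in; simp)+
  qed (auto simp: parts_in_def)
  ultimately have gf: "gf {p. 0 \<notin># p} = gf ?A * gf ?B"
    by simp
  have sum3: "sum_mset (image_mset (\<lambda>x. 3 * x) p) = 3 * sum_mset p" for p :: "nat multiset"
    by (induction p) auto
  have A: "fps_nth (gf ?A) (3 * k) = int (card (partitions_of k))" for k
  proof -
    have "bij_betw (image_mset (\<lambda>x. 3 * x)) (partitions_of k) {p \<in> ?A. sum_mset p = 3 * k}"
    proof (rule bij_betw_byWitness[where f' = "image_mset (\<lambda>x. x div 3)"])
      have *: "image_mset (\<lambda>x. 3 * x) (image_mset (\<lambda>x. x div 3) p) = p"
        if "\<forall>x\<in>#p. 3 dvd x" for p :: "nat multiset"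
        using that by (induction p) auto
      then show "\<forall>p\<in>{p \<in> ?A. sum_mset p = 3 * k}.
          image_mset (\<lambda>x. 3 * x) (image_mset (\<lambda>x. x div 3) p) = p"
        by (auto simp: parts_in_def)
      show "image_mset (\<lambda>x. x div 3) ` {p \<in> ?A. sum_mset p = 3 * k} \<subseteq> partitions_of k"
      proof (intro image_subsetI)
        fix p assume p: "p \<in> {p \<in> ?A. sum_mset p = 3 * k}"
        then have d: "\<forall>x\<in>#p. 3 dvd x" and pos: "\<forall>x\<in>#p. x > 0" and sum: "sum_mset p = 3 * k"
          by (auto simp: parts_in_def)
        have "3 * sum_mset (image_mset (\<lambda>x. x div 3) p) = sum_mset p"
          by (subst sum3[symmetric], subst *[OF d], rule refl)
        then have "sum_mset (image_mset (\<lambda>x. x div 3) p) = k"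
          using sum by linarith
        moreover have "0 \<notin># image_mset (\<lambda>x. x div 3) p"
        proof
          assume "0 \<in># image_mset (\<lambda>x. x div 3) p"
          then obtain x where "0 = x div 3" "x \<in># p"
            unfolding set_image_mset by (rule imageE)
          moreover from this obtain y where "x = 3 * y"
            using d by (meson dvdE)
          ultimately show False
            using bspec[OF pos \<open>x \<in># p\<close>] by simp
        qed
        ultimately show "image_mset (\<lambda>x. x div 3) p \<in> partitions_of k"
          unfolding partitions_of_def by blast
      qed
      show "image_mset (\<lambda>x. 3 * x) ` partitions_of k \<subseteq> {p \<in> ?A. sum_mset p = 3 * k}"
      proof (intro image_subsetI)
        fix p assume p: "p \<in> partitions_of k"
        then have "x > 0" if "x \<in># p" for x
          using that by (cases x) (auto simp: partitions_of_def)
        then show "image_mset (\<lambda>x. 3 * x) p \<in> {p \<in> ?A. sum_mset p = 3 * k}"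
          using p by (auto simp: parts_in_def partitions_of_def sum3)
      qed
    qed (simp add: multiset.map_comp comp_def)
    then show ?thesis
      by (simp add: gf_nth bij_betw_same_card)
  qed
  have A0: "fps_nth (gf ?A) i = 0" if "\<not> 3 dvd i" for i
  proof -
    have "3 dvd sum_mset p" if "\<forall>x\<in>#p. 3 dvd x" for p :: "nat multiset"
      using that by (induction p) auto
    then have "{p \<in> ?A. sum_mset p = i} = {}"
      using that by (auto simp: parts_in_def)
    then have "card {p \<in> ?A. sum_mset p = i} = 0"
      by (simp only: card.empty)
    then show ?thesis
      by (simp add: gf_nth)
  qed
  have B: "fps_nth (gf ?B) j = int (p3 j)" for j
  proof -
    have "[int x = 1] (mod 3) \<or> [int x = - 1] (mod 3) \<longleftrightarrow> \<not> 3 dvd x" for x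
    proof -
      have "(- 1 :: int) mod 3 = 2"
        by simp
      then show ?thesis
        unfolding cong_def by presburger
    qed
    then have "{p \<in> ?B. sum_mset p = j} = {p \<in> partitions_of j. \<forall>x\<in>#p. [int x = 1] (mod 3) \<or> [int x = - 1] (mod 3)}"
      by (auto simp: parts_in_def partitions_of_def)
    then show ?thesis
      by (simp add: gf_nth p3_def)
  qed
  have "int (card (partitions_of n)) = fps_nth (gf ?A * gf ?B) n"
    by (simp add: gf_nth partitions_of_def flip: gf)
  also have "\<dots> = (\<Sum>i\<in>{0..n}. fps_nth (gf ?A) i * int (p3 (n - i)))"
    by (simp add: fps_mult_nth B)
  also have "\<dots> = (\<Sum>i\<in>(\<lambda>k. 3 * k) ` {k. 3 * k \<le> n}. fps_nth (gf ?A) i * int (p3 (n - i)))"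
  proof (rule sum.mono_neutral_right)
    have "\<not> 3 dvd i" if "i \<in> {0..n} - (\<lambda>k. 3 * k) ` {k. 3 * k \<le> n}" for i
      using that by (auto elim!: dvdE)
    then show "\<forall>i\<in>{0..n} - (\<lambda>k. 3 * k) ` {k. 3 * k \<le> n}. fps_nth (gf ?A) i * int (p3 (n - i)) = 0"
      using A0 by simp
  qed auto
  also have "\<dots> = (\<Sum>k | 3 * k \<le> n. int (card (partitions_of k)) * int (p3 (n - 3 * k)))"
    by (subst sum.reindex) (auto simp: inj_on_def A)
  finally show ?thesis .
qed

section \<open>Tails of an integer statistic\<close>

lemma card_ge_step:
  fixes f :: "'a \<Rightarrow> int"
  assumes "finite S"
  shows "card {p \<in> S. a \<le> f p} = card {p \<in> S. f p = a} + card {p \<in> S. a + 1 \<le> f p}"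
proof -
  have "{p \<in> S. a \<le> f p} = {p \<in> S. f p = a} \<union> {p \<in> S. a + 1 \<le> f p}"
    by auto
  then show ?thesis
    using assms by (simp add: card_Un_disjoint disjoint_iff)
qed

lemma card_le_ge:
  fixes f :: "'a \<Rightarrow> int"
  assumes "finite S"
  shows "card S = card {p \<in> S. f p \<le> a} + card {p \<in> S. a + 1 \<le> f p}"
proof -
  have "S = {p \<in> S. f p \<le> a} \<union> {p \<in> S. a + 1 \<le> f p}"
    by auto
  moreover have "card ({p \<in> S. f p \<le> a} \<union> {p \<in> S. a + 1 \<le> f p})
      = card {p \<in> S. f p \<le> a} + card {p \<in> S. a + 1 \<le> f p}"
    using assms by (intro card_Un_disjoint) auto
  ultimately show ?thesis
    by simp
qed

lemma card_fibres:
  assumes "finite S" "finite V"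
  shows "card {p \<in> S. f p \<in> V} = (\<Sum>v\<in>V. card {p \<in> S. f p = v})"
proof -
  have "{p \<in> S. f p \<in> V} = (\<Union>v\<in>V. {p \<in> S. f p = v})"
    by auto
  also have "card \<dots> = (\<Sum>v\<in>V. card {p \<in> S. f p = v})"
    using assms by (intro card_UN_disjoint) auto
  finally show ?thesis .
qed

text \<open>A bound \<open>b\<close> for the absolute value of \<open>f\<close> on \<open>S\<close>
  makes both tails finite sums over fibres, where the symmetry applies termwise.\<close>

lemma card_le_eq_card_ge:
  fixes f :: "'a \<Rightarrow> int"
  assumes S: "finite S" and sym: "\<And>m. card {p \<in> S. f p = - m} = card {p \<in> S. f p = m}"
  shows "card {p \<in> S. f p \<le> - a} = card {p \<in> S. a \<le> f p}"
proof -
  obtain b where b: "\<And>p. p \<in> S \<Longrightarrow> \<bar>f p\<bar> \<le> b"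
    using finite_imageI[OF S, of "\<lambda>p. \<bar>f p\<bar>"] by (meson Max_ge imageI)
  have "{p \<in> S. a \<le> f p} = {p \<in> S. f p \<in> {a..b}}" "{p \<in> S. f p \<le> - a} = {p \<in> S. f p \<in> uminus ` {a..b}}"
    using b by (fastforce simp: abs_le_iff)+
  moreover have "(\<Sum>v\<in>uminus ` {a..b}. card {p \<in> S. f p = v}) = (\<Sum>v\<in>{a..b}. card {p \<in> S. f p = - v})"
    by (subst sum.reindex) (auto simp: inj_on_def)
  ultimately show ?thesis
    using S by (simp only: card_fibres finite_imageI finite_atLeastAtMost_int sym)
qed

section \<open>Recurrence for rank tails\<close>

text \<open>The empty partition is excluded because its rank involves the unspecified
  \<open>Max {}\<close>.\<close>

definition rank_ge :: "int \<Rightarrow> nat \<Rightarrow> int" where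
  "rank_ge m n = int (card {p \<in> partitions_of n. p \<noteq> {#} \<and> m \<le> partition_rank p})"

lemma partitions_of_0: "partitions_of 0 = {{#}}"
proof -
  have "p = {#}" if "0 \<notin># p" "sum_mset p = 0" for p :: "nat multiset"
    using size_le_sum_mset[OF that(1)] that(2) by simp
  then show ?thesis
    by (auto simp: partitions_of_def)
qed

lemma partitions_of_pos: "n > 0 \<Longrightarrow> {p \<in> partitions_of n. p \<noteq> {#} \<and> P p} = {p \<in> partitions_of n. P p}"
  by (auto simp: partitions_of_def)

lemma rank_ge_0: "rank_ge m 0 = 0"
  by (simp add: rank_ge_def partitions_of_0)

text \<open>The excluded case is the convention \<open>N_rank 0 0 = 1\<close>, which counts the
  empty partition.\<close>

lemma rank_ge_step:
  assumes "n > 0 \<or> m \<noteq> 0"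
  shows "rank_ge m n = int (N_rank m n) + rank_ge (m + 1) n"
proof (cases "n = 0")
  case False
  then show ?thesis
    using card_ge_step[OF finite_partitions_of[of n], of m partition_rank]
    by (simp add: rank_ge_def partitions_of_pos N_rank_def)
qed (use assms in \<open>simp add: rank_ge_0 N_rank_def\<close>)

lemma rank_ge_eq_0:
  assumes "n < r"
  shows "rank_ge (int r - 1) n = 0"
proof -
  have "partition_rank p < int r - 1" if "p \<in> partitions_of n" "p \<noteq> {#}" for p
  proof -
    have "largest_part p \<le> n"
      using part_le_sum[OF largest_part_in] that by (auto simp: partitions_of_def)
    moreover have "size p > 0"
      using that by (simp add: nonempty_has_size)
    ultimately show ?thesis
      using assms by (simp add: partition_rank_def)
  qed
  then have "{p \<in> partitions_of n. p \<noteq> {#} \<and> int r - 1 \<le> partition_rank p} = {}"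
    by fastforce
  then show ?thesis
    unfolding rank_ge_def by (simp only: card.empty)
qed

lemma card_empty_or_le:
  "int (card {p \<in> partitions_of n. p = {#} \<or> f p \<le> (a :: int)})
    = int (card (partitions_of n)) - int (card {p \<in> partitions_of n. p \<noteq> {#} \<and> a + 1 \<le> f p})"
proof -
  have "partitions_of n = {p \<in> partitions_of n. p = {#} \<or> f p \<le> a}
      \<union> {p \<in> partitions_of n. p \<noteq> {#} \<and> a + 1 \<le> f p}"
    by auto
  moreover have "card ({p \<in> partitions_of n. p = {#} \<or> f p \<le> a}
      \<union> {p \<in> partitions_of n. p \<noteq> {#} \<and> a + 1 \<le> f p})
    = card {p \<in> partitions_of n. p = {#} \<or> f p \<le> a}
      + card {p \<in> partitions_of n. p \<noteq> {#} \<and> a + 1 \<le> f p}"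
    using finite_partitions_of[of n] by (intro card_Un_disjoint) auto
  ultimately show ?thesis
    by simp
qed

text \<open>Dyson's adjoint after taking complements. The threshold rises by 3, so
  \<open>r = 3 * m\<close> leads from \<open>3 * m - 1\<close> to
  \<open>3 * (m + 1) - 1\<close>.\<close>

lemma rank_ge_rec:
  assumes "r \<ge> 1"
  shows "rank_ge (int r - 1) (n + r) = int (card (partitions_of n)) - rank_ge (int r + 2) n"
  unfolding rank_ge_def dyson_adjoint[OF assms] card_empty_or_le by (simp add: add.assoc)

text \<open>By symmetry the ranks at most -2 are as frequent as those at least 2.\<close>

lemma N_rank_middle:
  "int (N_rank (- 1) n) + int (N_rank 0 n) + int (N_rank 1 n) = int (card (partitions_of n)) - 2 * rank_ge 2 n"
proof (cases "n = 0")
  case False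
  then have "int (card (partitions_of n)) = int (card {p \<in> partitions_of n. partition_rank p \<le> - 2}) + rank_ge (- 1) n"
    using card_le_ge[OF finite_partitions_of[of n], of partition_rank "- 2"]
    by (simp add: rank_ge_def partitions_of_pos)
  also have "card {p \<in> partitions_of n. partition_rank p \<le> - 2} = card {p \<in> partitions_of n. 2 \<le> partition_rank p}"
    using False by (intro card_le_eq_card_ge finite_partitions_of rank_sym) simp
  also have "int \<dots> = rank_ge 2 n"
    using False by (simp add: rank_ge_def partitions_of_pos)
  finally show ?thesis
    using False rank_ge_step[of n "- 1"] rank_ge_step[of n 0] rank_ge_step[of n 1] by simp
qed (simp add: N_rank_def rank_ge_0 partitions_of_0)

section \<open>Recurrence for crank tails\<close>

text \<open>The negative tail fits the convention at \<open>n = 1\<close>: the partition of 1 has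
  crank -1, so this gives 1 for \<open>m = 1\<close>, whereas the positive tail would give
  0.\<close>

definition crank_le_neg :: "nat \<Rightarrow> nat \<Rightarrow> int" where
  "crank_le_neg m n = int (card {p \<in> partitions_of n. p \<noteq> {#} \<and> int m \<le> - partition_crank p})"

lemma crank_le_neg_0: "crank_le_neg m 0 = 0"
  by (simp add: crank_le_neg_def partitions_of_0)

lemma partitions_of_1: "partitions_of 1 = {{#1#}}"
proof -
  have "p = {#1#}" if p: "0 \<notin># p" "sum_mset p = 1" for p :: "nat multiset"
  proof -
    have "size p > 0"
      using p by (auto simp flip: nonempty_has_size)
    then have "size p = 1"
      using size_le_sum_mset[OF p(1)] p(2) by simp
    then obtain x where "p = {#x#}"
      using size_1_singleton_mset by blast
    then show ?thesis
      using p by simp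
  qed
  then show ?thesis
    by (auto simp: partitions_of_def)
qed

lemma crank_1: "partition_crank {#1#} = - 1"
  by (simp add: partition_crank_def)

lemma crank_le_neg_1: "m \<ge> 1 \<Longrightarrow> crank_le_neg m 1 = (if m = 1 then 1 else 0)"
proof -
  assume "m \<ge> 1"
  then have "{p \<in> partitions_of 1. p \<noteq> {#} \<and> int m \<le> - partition_crank p} = (if m = 1 then {{#1#}} else {})"
    unfolding partitions_of_1 using crank_1 by auto
  then show ?thesis
    unfolding crank_le_neg_def by (simp only:) simp
qed

lemma crank_sym:
  assumes "n \<ge> 2"
  shows "card {p \<in> partitions_of n. partition_crank p = - m} = card {p \<in> partitions_of n. partition_crank p = m}"
proof -
  consider "m = 0" | "m = int (nat m)" "nat m \<ge> 1" | "m = - int (nat (- m))" "nat (- m) \<ge> 1"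
    by linarith
  then show ?thesis
  proof cases
    case 2
    then show ?thesis
      using crank_sym_pos[OF assms, of "nat m"] by simp
  next
    case 3
    then show ?thesis
      using crank_sym_pos[OF assms, of "nat (- m)"] by simp
  qed simp
qed

lemma M_crank_minus: "M_crank (- m) n = M_crank m n"
  by (auto simp: M_crank_def crank_sym)

lemma M_crank_pos:
  assumes "m \<ge> 1"
  shows "M_crank (int m) n = crank_le_neg m n - crank_le_neg (Suc m) n"
proof -
  consider "n = 0" | "n = 1" | "n \<ge> 2"
    by linarith
  then show ?thesis
  proof cases
    case 1
    then show ?thesis
      using assms by (simp add: M_crank_def crank_le_neg_0)
  next
    case 2
    then show ?thesis
      using assms crank_le_neg_1[of m] crank_le_neg_1[of "Suc m"] by (simp add: M_crank_def)
  next
    case 3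
    have "card {p \<in> partitions_of n. int m = - partition_crank p} = card {p \<in> partitions_of n. partition_crank p = - int m}"
      by (rule arg_cong[where f = card]) auto
    then show ?thesis
      using 3 card_ge_step[OF finite_partitions_of[of n], of "int m" "\<lambda>p. - partition_crank p"]
      by (simp add: M_crank_def crank_le_neg_def partitions_of_pos crank_sym add.commute eq_commute[of "int m"])
  qed
qed

text \<open>Symmetry identifies the tails for \<open>n \<ge> 2\<close>. At \<open>n = 1\<close>,
  \<open>m = 1\<close> they are 0 and 1.\<close>

lemma card_crank_ge:
  assumes "m \<ge> 1" "n \<noteq> 1 \<or> m \<ge> 2"
  shows "int (card {p \<in> partitions_of n. p \<noteq> {#} \<and> int m \<le> partition_crank p}) = crank_le_neg m n"
proof -
  consider "n = 0" | "n = 1" "m \<ge> 2" | "n \<ge> 2"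
    using assms by linarith
  then show ?thesis
  proof cases
    case 1
    then show ?thesis
      by (simp add: crank_le_neg_0 partitions_of_0)
  next
    case 2
    have "{p \<in> partitions_of 1. p \<noteq> {#} \<and> int m \<le> partition_crank p} = {}"
      unfolding partitions_of_1 using crank_1 by auto
    then have "card {p \<in> partitions_of 1. p \<noteq> {#} \<and> int m \<le> partition_crank p} = 0"
      by (simp only: card.empty)
    then show ?thesis
      using 2 crank_le_neg_1[of m] by simp
  next
    case 3
    have "card {p \<in> partitions_of n. partition_crank p \<le> - int m} = card {p \<in> partitions_of n. int m \<le> partition_crank p}"
      using 3 by (intro card_le_eq_card_ge finite_partitions_of crank_sym)
    then show ?thesis
      using 3 by (simp add: crank_le_neg_def partitions_of_pos le_minus_iff)
  qed
qed

text \<open>For \<open>n \<ge> 2\<close> both tails are removed from the total; at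
  \<open>n = 1\<close> the formula gives 1 - 2 = -1, the conventional value.\<close>

lemma M_crank_zero: "M_crank 0 n = int (card (partitions_of n)) - 2 * crank_le_neg 1 n"
proof -
  consider "n = 0" | "n = 1" | "n \<ge> 2"
    by linarith
  then show ?thesis
  proof cases
    case 1
    then show ?thesis
      by (simp add: M_crank_def crank_le_neg_0 partitions_of_0)
  next
    case 2
    then show ?thesis
      using partitions_of_1 crank_le_neg_1[of 1] by (simp add: M_crank_def)
  next
    case 3
    have "int (card {p \<in> partitions_of n. 1 \<le> partition_crank p}) = crank_le_neg 1 n"
      using 3 card_crank_ge[of 1 n] by (simp add: partitions_of_pos)
    moreover have "1 \<le> - partition_crank p \<longleftrightarrow> partition_crank p \<le> - 1" for p
      by linarith
    then have "int (card {p \<in> partitions_of n. partition_crank p \<le> - 1}) = crank_le_neg 1 n"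
      using 3 by (simp add: crank_le_neg_def partitions_of_pos)
    moreover have "card (partitions_of n)
        = card {p \<in> partitions_of n. partition_crank p \<le> - 1} + card {p \<in> partitions_of n. 0 \<le> partition_crank p}"
      using card_le_ge[OF finite_partitions_of[of n], of partition_crank "- 1"] by simp
    moreover have "card {p \<in> partitions_of n. 0 \<le> partition_crank p}
        = card {p \<in> partitions_of n. partition_crank p = 0} + card {p \<in> partitions_of n. 1 \<le> partition_crank p}"
      using card_ge_step[OF finite_partitions_of[of n], of 0 partition_crank] by simp
    ultimately show ?thesis
      using 3 by (simp add: M_crank_def)
  qed
qed

text \<open>The complement in \<open>crank_adjoint\<close> has cranks at least \<open>m + 1\<close>.
  As \<open>m + 1 \<ge> 2\<close>, \<open>card_crank_ge\<close> applies even at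
  \<open>n = 1\<close>.\<close>

lemma crank_le_neg_rec:
  assumes "m \<ge> 1"
  shows "crank_le_neg m (n + m) = int (card (partitions_of n)) - crank_le_neg (Suc m) n"
proof -
  have "crank_le_neg m (n + m) = int (card {p \<in> partitions_of n. p = {#} \<or> partition_crank p \<le> int m})"
    using crank_adjoint[OF assms, of n] by (simp add: crank_le_neg_def le_minus_iff)
  also have "\<dots> = int (card (partitions_of n)) - crank_le_neg (Suc m) n"
    using card_crank_ge[of "Suc m" n] assms by (simp add: card_empty_or_le add.commute)
  finally show ?thesis .
qed

lemma crank_le_neg_eq_0:
  assumes "n < m"
  shows "crank_le_neg m n = 0"
proof -
  \<comment> \<open>Without ones the crank is a natural number, even for the unspecified
    \<open>largest_part {#}\<close>; with ones it is at least minus their number.\<close>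
  have "- partition_crank p < int m" if "p \<in> partitions_of n" for p
  proof (cases "count p 1 = 0")
    case True
    then show ?thesis
      using assms by (simp add: crank_no_ones)
  next
    case False
    then show ?thesis
      using count_le_sum[of p] that assms
      by (simp add: crank_with_ones partitions_of_def del: One_nat_def)
  qed
  then have "{p \<in> partitions_of n. p \<noteq> {#} \<and> int m \<le> - partition_crank p} = {}"
    by fastforce
  then show ?thesis
    unfolding crank_le_neg_def by (simp only: card.empty)
qed

text \<open>
  By \<open>rank_ge_rec\<close>, \<open>crank_le_neg_rec\<close> and \<open>partitions_conv_p3\<close>, both sides \<open>a m n\<close> satisfy
  \<open>a m (n + 3m) = p(n) - a (m + 1) n\<close> and vanish for \<open>n < 3m\<close>.
\<close>

lemma rank_ge_eq_crank_sum:
  assumes "m \<ge> 1"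
  shows "rank_ge (3 * int m - 1) n = (\<Sum>k | 3 * k \<le> n. crank_le_neg m k * int (p3 (n - 3 * k)))"
  using assms
proof (induction n arbitrary: m rule: less_induct)
  case (less n)
  show ?case
  proof (cases "n < 3 * m")
    case True
    then have "rank_ge (3 * int m - 1) n = 0"
      using rank_ge_eq_0[of n "3 * m"] by simp
    moreover have "crank_le_neg m k = 0" if "3 * k \<le> n" for k
      using that True by (intro crank_le_neg_eq_0) linarith
    ultimately show ?thesis
      by simp
  next
    case False
    define l where "l = n - 3 * m"
    have n: "n = l + 3 * m" and "l < n"
      using False less.prems by (auto simp: l_def)
    have fin: "finite {k. 3 * k \<le> j}" for j :: nat
      by (rule finite_subset[of _ "{..j}"]) auto
    \<comment> \<open>Terms with \<open>k < m\<close> vanish; the rest are reindexed by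
      \<open>k + m\<close>, turning the bound \<open>n\<close> into \<open>l\<close>.\<close>
    have "(\<Sum>k | 3 * k \<le> n. crank_le_neg m k * int (p3 (n - 3 * k)))
        = (\<Sum>k\<in>(\<lambda>k. k + m) ` {k. 3 * k \<le> l}. crank_le_neg m k * int (p3 (n - 3 * k)))"
    proof (rule sum.mono_neutral_right[OF fin])
      show "(\<lambda>k. k + m) ` {k. 3 * k \<le> l} \<subseteq> {k. 3 * k \<le> n}"
        by (auto simp: n)
      show "\<forall>k\<in>{k. 3 * k \<le> n} - (\<lambda>k. k + m) ` {k. 3 * k \<le> l}. crank_le_neg m k * int (p3 (n - 3 * k)) = 0"
      proof
        fix k assume k: "k \<in> {k. 3 * k \<le> n} - (\<lambda>k. k + m) ` {k. 3 * k \<le> l}"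
        have "k < m"
        proof (rule ccontr)
          assume "\<not> k < m"
          then have "k = (k - m) + m" "k - m \<in> {k. 3 * k \<le> l}"
            using k n by auto
          then show False
            using k by blast
        qed
        then show "crank_le_neg m k * int (p3 (n - 3 * k)) = 0"
          by (simp add: crank_le_neg_eq_0)
      qed
    qed
    also have "\<dots> = (\<Sum>k | 3 * k \<le> l. crank_le_neg m (k + m) * int (p3 (l - 3 * k)))"
      by (subst sum.reindex) (auto simp: inj_on_def n intro!: sum.cong)
    also have "\<dots> = (\<Sum>k | 3 * k \<le> l. int (card (partitions_of k)) * int (p3 (l - 3 * k))
        - crank_le_neg (Suc m) k * int (p3 (l - 3 * k)))"
      using less.prems by (simp add: crank_le_neg_rec left_diff_distrib)
    also have "\<dots> = int (card (partitions_of l)) - rank_ge (3 * int (Suc m) - 1) l"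
      using less.IH[OF \<open>l < n\<close>, of "Suc m"] by (simp add: sum_subtractf flip: partitions_conv_p3)
    also have "\<dots> = rank_ge (3 * int m - 1) n"
      using rank_ge_rec[of "3 * m" l] less.prems by (simp add: n add.commute)
    finally show ?thesis ..
  qed
qed

section \<open>From tails to single values\<close>

text \<open>For \<open>m \<ge> 1\<close> both sides are differences of consecutive tails; none of
  the three ranks is 0, so \<open>rank_ge_step\<close> also covers \<open>n = 0\<close>. For
  \<open>m = 0\<close> both sides are the total minus two tails.\<close>

lemma rank_crank_nonneg:
  "int (N_rank (3 * int m - 1) n) + int (N_rank (3 * int m) n) + int (N_rank (3 * int m + 1) n)
    = (\<Sum>k | 3 * k \<le> n. M_crank (int m) k * int (p3 (n - 3 * k)))"
proof (cases "m = 0")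
  case True
  have "(\<Sum>k | 3 * k \<le> n. M_crank 0 k * int (p3 (n - 3 * k)))
      = (\<Sum>k | 3 * k \<le> n. int (card (partitions_of k)) * int (p3 (n - 3 * k))
        - 2 * (crank_le_neg 1 k * int (p3 (n - 3 * k))))"
    by (simp add: M_crank_zero left_diff_distrib mult.assoc)
  also have "\<dots> = int (card (partitions_of n)) - 2 * rank_ge 2 n"
    using rank_ge_eq_crank_sum[of 1 n]
    by (simp add: sum_subtractf flip: partitions_conv_p3 sum_distrib_left)
  finally show ?thesis
    using True N_rank_middle[of n] by simp
next
  case False
  then have m: "m \<ge> 1"
    by simp
  have "(\<Sum>k | 3 * k \<le> n. M_crank (int m) k * int (p3 (n - 3 * k)))
      = rank_ge (3 * int m - 1) n - rank_ge (3 * int (Suc m) - 1) n"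
    using m rank_ge_eq_crank_sum[of m n] rank_ge_eq_crank_sum[of "Suc m" n]
    by (simp add: M_crank_pos left_diff_distrib sum_subtractf)
  then show ?thesis
    using m rank_ge_step[of n "3 * int m - 1"] rank_ge_step[of n "3 * int m"]
      rank_ge_step[of n "3 * int m + 1"] by simp
qed

theorem theorem1p4:
  fixes m :: int and n :: nat
  shows "int (N_rank (3 * m - 1) n) + int (N_rank (3 * m) n) + int (N_rank (3 * m + 1) n)
    = (\<Sum>k | 3 * k \<le> n. M_crank m k * int (p3 (n - 3 * k)))"
proof (cases "m \<ge> 0")
  case True
  then show ?thesis
    using rank_crank_nonneg[of "nat m" n] by simp
next
  case False
  have "N_rank (3 * m - 1) n = N_rank (3 * (- m) + 1) n" "N_rank (3 * m) n = N_rank (3 * (- m)) n"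
      "N_rank (3 * m + 1) n = N_rank (3 * (- m) - 1) n"
    using N_rank_minus[of "3 * m - 1" n] N_rank_minus[of "3 * m" n] N_rank_minus[of "3 * m + 1" n]
    by simp_all
  then show ?thesis
    using False rank_crank_nonneg[of "nat (- m)" n] by (simp add: M_crank_minus)
qed

end
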